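(* Let $\mathcal G=(V,E)$ be a connected simple graph with Beurling dimension $d$ and normal counting measure $\mu$, and let $X_n$, $n\ge1$, be a stationary Markov chain on $\mathcal G$ with transition matrix $P\in\mathcal B_{\infty,\alpha}(\mathcal G)$ for some $\alpha>d+1$. Then there exists a positive constant $C_\alpha$ such that $$\Pr(X_m=\lambda\mid X_n=\lambda')\le\min\Big(C_\alpha(m-n)^{\alpha+1}(\rho(\lambda,\lambda'))^{-\alpha},\,1\Big)$$ for all $\lambda,\lambda'\in V$ and all integers $m>n\ge1$ (the right-hand side being read as $1$ when $\lambda=\lambda'$).
   Context: A simple graph is an unweighted, undirected graph without loops or multiple edges. For a connected simple graph $\mathcal G=(V,E)$, $\rho(\lambda,\lambda')$ is the geodesic distance on $V$ (number of edges in a shortest path), $B(\lambda,R)=\{\lambda'\in V:\rho(\lambda,\lambda')\le R\}$, and $\mu$ is the counting measure on $V$. It has polynomial growth if there are positive constants $D_1(\mathcal G)$ and $d$ with $\mu(B(\lambda,R))\le D_1(\mathcal G)(R+1)^d$ for all $\lambda\in V$, $R\ge0$; the minimal constants $d$ and $D_1(\mathcal G)$ are called the Beurling dimension and density of $\mathcal G$. The counting measure is normal if there are positive constants $D_1(\mathcal G),D_2(\mathcal G)$ with $D_2(\mathcal G)(R+1)^d\le\mu(B(\lambda,R))\le D_1(\mathcal G)(R+1)^d$ for all $\lambda\in V$ and $0\le R\le\mathrm{diam}(\mathcal G)$. $\mathcal B_{\infty,\alpha}(\mathcal G)$ is the set of matrices $A=(a(\lambda,\lambda'))_{\lambda,\lambda'\in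 V}$ with $\sup_{n\ge0}h_A(n)(n+1)^\alpha<\infty$, where $h_A(n)=\sup_{\rho(\lambda,\lambda')\ge n}|a(\lambda,\lambda')|$. A stationary Markov chain on $\mathcal G$ is a (time-homogeneous) Markov chain with state space $V$ such that $\Pr(X_{n+1}=\lambda\mid X_n=\lambda')=p(\lambda,\lambda')$ is independent of $n\ge1$; its transition matrix is $P=(p(\lambda,\lambda'))_{\lambda,\lambda'\in V}$ (so $\sum_{\lambda\in V}p(\lambda,\lambda')=1$ for each $\lambda'$, and $\Pr(X_m=\lambda\mid X_n=\lambda')$ is the $(\lambda,\lambda')$ entry of $P^{m-n}$). The constant $C_\alpha$ is independent of $\lambda,\lambda',m,n$ and may depend on $\mathcal G$, $\alpha$ and $P$. *)

theory Defs
  imports "HOL-Probability.Probability"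
begin

definition simple_graph :: "'a set \<Rightarrow> 'a set set \<Rightarrow> bool" where
  "simple_graph V E \<longleftrightarrow> (\<forall>e\<in>E. e \<subseteq> V \<and> card e = 2)"

definition walk :: "'a set \<Rightarrow> 'a set set \<Rightarrow> 'a \<Rightarrow> 'a list \<Rightarrow> 'a \<Rightarrow> bool" where
  "walk V E u xs v \<longleftrightarrow>
     xs \<noteq> [] \<and> set xs \<subseteq> V \<and> hd xs = u \<and> last xs = v \<and> successively (\<lambda>x y. {x, y} \<in> E) xs"

definition connected_graph :: "'a set \<Rightarrow> 'a set set \<Rightarrow> bool" where
  "connected_graph V E \<longleftrightarrow> (\<forall>u\<in>V. \<forall>v\<in>V. \<exists>xs. walk V E u xs v)"

text \<open>A walk with \<open>n + 1\<close> vertices has \<open>n\<close> edges; a shortest walk is a shortest path.\<close>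

definition geodesic_dist :: "'a set \<Rightarrow> 'a set set \<Rightarrow> 'a \<Rightarrow> 'a \<Rightarrow> nat" where
  "geodesic_dist V E u v = (LEAST n. \<exists>xs. walk V E u xs v \<and> length xs = Suc n)"

definition graph_ball :: "'a set \<Rightarrow> 'a set set \<Rightarrow> 'a \<Rightarrow> real \<Rightarrow> 'a set" where
  "graph_ball V E u R = {v\<in>V. real (geodesic_dist V E u v) \<le> R}"

definition graph_diam :: "'a set \<Rightarrow> 'a set set \<Rightarrow> ereal" where
  "graph_diam V E = (SUP u\<in>V. SUP v\<in>V. ereal (real (geodesic_dist V E u v)))"

definition growth_bound :: "'a set \<Rightarrow> 'a set set \<Rightarrow> real \<Rightarrow> real \<Rightarrow> bool" where
  "growth_bound V E D d \<longleftrightarrow>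
     (\<forall>u\<in>V. \<forall>R\<ge>0. emeasure (count_space V) (graph_ball V E u R) \<le> ennreal (D * (R + 1) powr d))"

text \<open>
  The minimal growth exponent is taken as the infimum of the admissible positive exponents of a
  graph of polynomial growth. On a finite graph every positive exponent is admissible, no least one
  exists, and the dimension is 0.
\<close>

definition has_beurling_dimension :: "'a set \<Rightarrow> 'a set set \<Rightarrow> real \<Rightarrow> bool" where
  "has_beurling_dimension V E d \<longleftrightarrow>
     (\<exists>d'>0. \<exists>D>0. growth_bound V E D d') \<and>
     d = Inf {d'. d' > 0 \<and> (\<exists>D>0. growth_bound V E D d')}"

definition normal_counting_measure :: "'a set \<Rightarrow> 'a set set \<Rightarrow> real \<Rightarrow> bool" where
  "normal_counting_measure V E d \<longleftrightarrow>
     (\<exists>D1>0. \<exists>D2>0. \<forall>u\<in>V. \<forall>R\<ge>0. ereal R \<le> graph_diam V E \<longrightarrow>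
        ennreal (D2 * (R + 1) powr d) \<le> emeasure (count_space V) (graph_ball V E u R) \<and>
        emeasure (count_space V) (graph_ball V E u R) \<le> ennreal (D1 * (R + 1) powr d))"

text \<open>
  Matrices indexed by \<open>V\<close> are functions of two arguments, of which only the values on \<open>V \<times> V\<close>
  matter. Suprema are taken in \<^typ>\<open>ennreal\<close>, so they may be infinite, and the supremum over the
  empty set is 0.
\<close>

definition off_diag_sup ::
    "'a set \<Rightarrow> 'a set set \<Rightarrow> ('a \<Rightarrow> 'a \<Rightarrow> 'k::real_normed_vector) \<Rightarrow> nat \<Rightarrow> ennreal" where
  "off_diag_sup V E A n =
     (SUP (u, v) \<in> {(u, v) \<in> V \<times> V. geodesic_dist V E u v \<ge> n}. ennreal (norm (A u v)))"

definition Beurling_inf ::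
    "'a set \<Rightarrow> 'a set set \<Rightarrow> real \<Rightarrow> ('a \<Rightarrow> 'a \<Rightarrow> 'k::real_normed_vector) set" where
  "Beurling_inf V E \<alpha> =
     {A. (SUP n. off_diag_sup V E A n * ennreal ((real n + 1) powr \<alpha>)) < \<infinity>}"

text \<open>
  Columns of a transition matrix sum to 1: \<open>p u v\<close> is the probability of moving from \<open>v\<close> to \<open>u\<close>.
  The conditional probabilities are prescribed only where the conditioning event has positive
  probability.
\<close>

definition stochastic_matrix :: "'a set \<Rightarrow> ('a \<Rightarrow> 'a \<Rightarrow> real) \<Rightarrow> bool" where
  "stochastic_matrix V p \<longleftrightarrow>
     (\<forall>v\<in>V. (\<forall>u\<in>V. p u v \<ge> 0) \<and> ((\<lambda>u. p u v) has_sum 1) V)"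

definition stationary_markov_chain ::
    "'b measure \<Rightarrow> 'a set \<Rightarrow> ('a \<Rightarrow> 'a \<Rightarrow> real) \<Rightarrow> (nat \<Rightarrow> 'b \<Rightarrow> 'a) \<Rightarrow> bool" where
  "stationary_markov_chain M V p X \<longleftrightarrow>
     prob_space M \<and>
     (\<forall>n\<ge>1. X n \<in> M \<rightarrow>\<^sub>M count_space V) \<and>
     stochastic_matrix V p \<and>
     (\<forall>n\<ge>1. \<forall>x. (\<forall>i\<in>{1..Suc n}. x i \<in> V) \<longrightarrow>
        \<P>(\<omega> in M. \<forall>i\<in>{1..n}. X i \<omega> = x i) > 0 \<longrightarrow>
        \<P>(\<omega> in M. X (Suc n) \<omega> = x (Suc n) \<bar> \<forall>i\<in>{1..n}. X i \<omega> = x i) =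
        \<P>(\<omega> in M. X (Suc n) \<omega> = x (Suc n) \<bar> X n \<omega> = x n)) \<and>
     (\<forall>n\<ge>1. \<forall>u\<in>V. \<forall>v\<in>V. \<P>(\<omega> in M. X n \<omega> = v) > 0 \<longrightarrow>
        \<P>(\<omega> in M. X (Suc n) \<omega> = u \<bar> X n \<omega> = v) = p u v)"

fun matrix_pow :: "'a set \<Rightarrow> ('a \<Rightarrow> 'a \<Rightarrow> real) \<Rightarrow> nat \<Rightarrow> 'a \<Rightarrow> 'a \<Rightarrow> real" where
  "matrix_pow V p 0 u v = (if u = v then 1 else 0)"
| "matrix_pow V p (Suc k) u v = (\<Sum>\<^sub>\<infinity>w\<in>V. p u w * matrix_pow V p k w v)"

text \<open>
  The probability of \<open>X m = u\<close> given \<open>X n = v\<close>, for \<open>m > n\<close>. If \<open>X n = v\<close> has probability 0,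
  the quotient of probabilities is meaningless (and 0 in HOL); the value is then the entry of
  the power of the transition matrix, with which the quotient agrees in all other cases.
\<close>

definition chain_prob ::
    "'b measure \<Rightarrow> 'a set \<Rightarrow> ('a \<Rightarrow> 'a \<Rightarrow> real) \<Rightarrow> (nat \<Rightarrow> 'b \<Rightarrow> 'a) \<Rightarrow> nat \<Rightarrow> nat \<Rightarrow> 'a \<Rightarrow> 'a \<Rightarrow> real"
  where
  "chain_prob M V p X m n u v =
     (if \<P>(\<omega> in M. X n \<omega> = v) > 0 then \<P>(\<omega> in M. X m \<omega> = u \<bar> X n \<omega> = v)
      else matrix_pow V p (m - n) u v)"

end

theory Submission
  imports Defs
begin

text \<open>
  A path of \<open>k\<close> steps from \<open>v\<close> to \<open>u\<close>, at distance \<open>r = \<rho>(u, v)\<close>, either makes a jump longer than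
  \<open>b = r / \<alpha>\<close>, or makes only jumps of length at most \<open>b\<close>. Since \<open>\<alpha> > d + 1\<close>, the mean jump length is
  bounded, and Chernoff's method with weight \<open>(b / k) powr (\<rho> / b)\<close> shows that paths of the second
  kind contribute \<open>O((k / r) powr \<alpha>)\<close>. A single long jump has probability \<open>O(r powr - \<alpha>)\<close>; summing
  over the time at which it occurs and over its end point contributes \<open>O(r powr - \<alpha>)\<close> times the sum
  of the row sums \<open>R\<^sub>i\<close> of \<open>P\<^sup>i\<close>, \<open>i < k\<close>. Row sums need not be bounded, but \<open>R\<^sub>i = O((i + 1) powr \<alpha>)\<close>
  follows by induction: inside a ball of radius \<open>l i\<close> the entries of \<open>P\<^sup>i\<close> are at most \<open>1\<close>, outside
  of it the bound by the earlier row sums applies and gains a factor \<open>1 / l\<close>, which for large \<open>l\<close>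
  closes the induction. Matrix entries are taken in \<^typ>\<open>ennreal\<close>, where the sums over \<open>V\<close> always exist.
\<close>

section \<open>Powers of nonnegative kernels on a countable set\<close>

fun kernel_pow :: "'a set \<Rightarrow> ('a \<Rightarrow> 'a \<Rightarrow> ennreal) \<Rightarrow> nat \<Rightarrow> 'a \<Rightarrow> 'a \<Rightarrow> ennreal" where
  "kernel_pow V t 0 u v = (if u = v then 1 else 0)"
| "kernel_pow V t (Suc k) u v = (\<integral>\<^sup>+w. t u w * kernel_pow V t k w v \<partial>count_space V)"

lemma kernel_pow_mono:
  assumes "\<And>u w. u \<in> V \<Longrightarrow> w \<in> V \<Longrightarrow> s u w \<le> t u w" and "u \<in> V"
  shows "kernel_pow V s k u v \<le> kernel_pow V t k u v"
  using assms(2)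
proof (induction k arbitrary: u)
  case (Suc k)
  then show ?case
    by (auto intro!: nn_integral_mono mult_mono assms(1))
qed simp

text \<open>A submultiplicative weight can be distributed over the steps of a path. Summing over the
  last end point first (Tonelli) then costs one factor \<open>M\<close> per step. The constant
  weight 1 gives ordinary column sums; an exponential weight in the distance gives Chernoff
  bounds.\<close>

lemma weighted_column_sum_kernel_pow:
  fixes \<omega> :: "'a \<Rightarrow> 'a \<Rightarrow> ennreal"
  assumes "countable V"
    and submult: "\<And>u w v. u \<in> V \<Longrightarrow> w \<in> V \<Longrightarrow> v \<in> V \<Longrightarrow> \<omega> u v \<le> \<omega> u w * \<omega> w v"
    and diag: "\<And>v. v \<in> V \<Longrightarrow> \<omega> v v \<le> 1"
    and column: "\<And>w. w \<in> V \<Longrightarrow> (\<integral>\<^sup>+u. t u w * \<omega> u w \<partial>count_space V) \<le> M"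
    and "v \<in> V"
  shows "(\<integral>\<^sup>+u. kernel_pow V t k u v * \<omega> u v \<partial>count_space V) \<le> M ^ k"
proof (induction k)
  case 0
  have "(\<integral>\<^sup>+u. kernel_pow V t 0 u v * \<omega> u v \<partial>count_space V) = (\<Sum>u\<in>{v}. kernel_pow V t 0 u v * \<omega> u v)"
    using \<open>v \<in> V\<close> by (intro nn_integral_count_space') auto
  then show ?case using diag[OF \<open>v \<in> V\<close>] by simp
next
  case (Suc k)
  let ?g = "\<lambda>w. kernel_pow V t k w v * \<omega> w v"
  have "(\<integral>\<^sup>+u. kernel_pow V t (Suc k) u v * \<omega> u v \<partial>count_space V)
      = (\<integral>\<^sup>+u. (\<integral>\<^sup>+w. t u w * kernel_pow V t k w v * \<omega> u v \<partial>count_space V) \<partial>count_space V)"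
    by (simp add: nn_integral_multc)
  also have "\<dots> \<le> (\<integral>\<^sup>+u. (\<integral>\<^sup>+w. (t u w * \<omega> u w) * ?g w \<partial>count_space V) \<partial>count_space V)"
  proof (intro nn_integral_mono)
    fix u w assume "u \<in> space (count_space V)" "w \<in> space (count_space V)"
    then have "\<omega> u v \<le> \<omega> u w * \<omega> w v" using submult \<open>v \<in> V\<close> by simp
    then have "(t u w * kernel_pow V t k w v) * \<omega> u v \<le> (t u w * kernel_pow V t k w v) * (\<omega> u w * \<omega> w v)"
      by (rule mult_left_mono) simp
    then show "t u w * kernel_pow V t k w v * \<omega> u v \<le> (t u w * \<omega> u w) * ?g w"
      by (simp add: mult_ac)
  qed
  also have "\<dots> = (\<integral>\<^sup>+w. (\<integral>\<^sup>+u. (t u w * \<omega> u w) * ?g w \<partial>count_space V) \<partial>count_space V)"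
    by (rule nn_integral_count_space_nn_integral) (use \<open>countable V\<close> in auto)
  also have "\<dots> = (\<integral>\<^sup>+w. (\<integral>\<^sup>+u. t u w * \<omega> u w \<partial>count_space V) * ?g w \<partial>count_space V)"
    by (simp add: nn_integral_multc)
  also have "\<dots> \<le> (\<integral>\<^sup>+w. M * ?g w \<partial>count_space V)"
    by (intro nn_integral_mono mult_right_mono column) auto
  also have "\<dots> = M * (\<integral>\<^sup>+w. ?g w \<partial>count_space V)"
    by (simp add: nn_integral_cmult)
  also have "\<dots> \<le> M * M ^ k"
    by (intro mult_left_mono Suc.IH) simp
  finally show ?case by simp
qed

lemma column_sum_kernel_pow_le_1:
  assumes "countable V" and "\<And>w. w \<in> V \<Longrightarrow> (\<integral>\<^sup>+u. t u w \<partial>count_space V) \<le> 1" and "v \<in> V"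
  shows "(\<integral>\<^sup>+u. kernel_pow V t k u v \<partial>count_space V) \<le> 1"
  using weighted_column_sum_kernel_pow[of V "\<lambda>_ _. 1" t 1 v k] assms by simp

lemma row_sum_kernel_pow_0:
  assumes "u \<in> V"
  shows "(\<integral>\<^sup>+v. kernel_pow V t 0 u v \<partial>count_space V) = 1"
proof -
  have "(\<integral>\<^sup>+v. kernel_pow V t 0 u v \<partial>count_space V) = (\<Sum>v\<in>{u}. kernel_pow V t 0 u v)"
    using assms by (intro nn_integral_count_space') auto
  then show ?thesis by simp
qed

lemma row_sum_kernel_pow_Suc:
  assumes "countable V"
  shows "(\<integral>\<^sup>+v. kernel_pow V t (Suc k) u v \<partial>count_space V)
    = (\<integral>\<^sup>+w. t u w * (\<integral>\<^sup>+v. kernel_pow V t k w v \<partial>count_space V) \<partial>count_space V)"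
proof -
  have "(\<integral>\<^sup>+v. kernel_pow V t (Suc k) u v \<partial>count_space V)
      = (\<integral>\<^sup>+w. (\<integral>\<^sup>+v. t u w * kernel_pow V t k w v \<partial>count_space V) \<partial>count_space V)"
    unfolding kernel_pow.simps
    by (rule nn_integral_count_space_nn_integral) (use assms in auto)
  then show ?thesis by (simp add: nn_integral_cmult)
qed

text \<open>
  The powers of \<open>t\<close> are expanded according to the leftmost factor that is not \<open>s\<close>: the factors to
  its right are powers of \<open>t\<close>, whose column sums are at most \<open>1\<close>.
\<close>

lemma kernel_pow_add_le:
  assumes "countable V"
    and split: "\<And>u w. u \<in> V \<Longrightarrow> w \<in> V \<Longrightarrow> t u w \<le> s u w + e"
    and column: "\<And>w. w \<in> V \<Longrightarrow> (\<integral>\<^sup>+u. t u w \<partial>count_space V) \<le> 1"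
    and "u \<in> V" "v \<in> V"
  shows "kernel_pow V t k u v
    \<le> kernel_pow V s k u v + e * (\<Sum>i<k. \<integral>\<^sup>+w. kernel_pow V s i u w \<partial>count_space V)"
  using \<open>u \<in> V\<close>
proof (induction k arbitrary: u)
  case (Suc k)
  let ?R = "\<lambda>i w. \<integral>\<^sup>+x. kernel_pow V s i w x \<partial>count_space V"
  let ?E = "\<lambda>w. \<Sum>i<k. ?R i w"
  have R0: "?R 0 u = 1" by (rule row_sum_kernel_pow_0) fact
  have "kernel_pow V t (Suc k) u v
      \<le> (\<integral>\<^sup>+w. (s u w + e) * kernel_pow V t k w v \<partial>count_space V)"
    unfolding kernel_pow.simps by (intro nn_integral_mono mult_right_mono split) (use Suc.prems in auto)
  also have "\<dots> = (\<integral>\<^sup>+w. s u w * kernel_pow V t k w v \<partial>count_space V)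
      + e * (\<integral>\<^sup>+w. kernel_pow V t k w v \<partial>count_space V)"
    by (simp add: distrib_right nn_integral_add nn_integral_cmult)
  also have "\<dots> \<le> (\<integral>\<^sup>+w. s u w * (kernel_pow V s k w v + e * ?E w) \<partial>count_space V) + e * 1"
    by (intro add_mono nn_integral_mono mult_left_mono Suc.IH column_sum_kernel_pow_le_1)
      (use assms in auto)
  also have "(\<integral>\<^sup>+w. s u w * (kernel_pow V s k w v + e * ?E w) \<partial>count_space V)
      = kernel_pow V s (Suc k) u v + e * (\<integral>\<^sup>+w. s u w * ?E w \<partial>count_space V)"
    by (simp add: distrib_left nn_integral_add mult.left_commute[of _ e] nn_integral_cmult)
  also have "(\<integral>\<^sup>+w. s u w * ?E w \<partial>count_space V) = (\<Sum>i<k. ?R (Suc i) u)"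
    by (simp add: sum_distrib_left nn_integral_sum row_sum_kernel_pow_Suc[OF \<open>countable V\<close>]
        del: kernel_pow.simps)
  \<comment> \<open>The lone \<open>e * 1\<close> supplies the summand for i = 0, as the row sum of
    the zeroth power is 1.\<close>
  also have "kernel_pow V s (Suc k) u v + e * (\<Sum>i<k. ?R (Suc i) u) + e * 1
      = kernel_pow V s (Suc k) u v + e * (\<Sum>i<Suc k. ?R i u)"
    unfolding sum.lessThan_Suc_shift R0 by (simp add: distrib_left add_ac del: kernel_pow.simps)
  finally show ?case .
qed simp

section \<open>Off-diagonal decay of the powers of a substochastic kernel\<close>

text \<open>The graph enters only through a metric with distinct points at distance at least 1, and
  its dimension only through \<open>dist_sum\<close>: the exponent 1 - \<alpha> is summable because
  \<alpha> - 1 exceeds the dimension.\<close>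

locale decaying_kernel =
  fixes V :: "'a set" and \<rho> :: "'a \<Rightarrow> 'a \<Rightarrow> real" and p :: "'a \<Rightarrow> 'a \<Rightarrow> ennreal"
    and \<alpha> A S :: real
  assumes countable_V: "countable V"
    and dist_same: "\<And>v. v \<in> V \<Longrightarrow> \<rho> v v = 0"
    and dist_ge_1: "\<And>u v. u \<in> V \<Longrightarrow> v \<in> V \<Longrightarrow> u \<noteq> v \<Longrightarrow> \<rho> u v \<ge> 1"
    and dist_commute: "\<And>u v. u \<in> V \<Longrightarrow> v \<in> V \<Longrightarrow> \<rho> u v = \<rho> v u"
    and dist_triangle: "\<And>u w v. u \<in> V \<Longrightarrow> w \<in> V \<Longrightarrow> v \<in> V \<Longrightarrow> \<rho> u v \<le> \<rho> u w + \<rho> w v"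
    and alpha: "\<alpha> > 1" and A_nonneg: "A \<ge> 0" and S_nonneg: "S \<ge> 0"
    and dist_sum: "\<And>u. u \<in> V \<Longrightarrow> (\<integral>\<^sup>+v. ennreal ((1 + \<rho> u v) powr (1 - \<alpha>)) \<partial>count_space V) \<le> ennreal S"
    and decay: "\<And>u v. u \<in> V \<Longrightarrow> v \<in> V \<Longrightarrow> p u v \<le> ennreal (A * (1 + \<rho> u v) powr (- \<alpha>))"
    and column: "\<And>v. v \<in> V \<Longrightarrow> (\<integral>\<^sup>+u. p u v \<partial>count_space V) \<le> 1"
begin

lemma dist_nonneg: "u \<in> V \<Longrightarrow> v \<in> V \<Longrightarrow> \<rho> u v \<ge> 0"
  by (cases "u = v") (use dist_same dist_ge_1[of u v] in auto)

lemma kernel_pow_le_1: "u \<in> V \<Longrightarrow> v \<in> V \<Longrightarrow> kernel_pow V p k u v \<le> 1"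
  using nn_integral_ge_point[where p = "\<lambda>u. kernel_pow V p k u v" and x = u and A = V]
    column_sum_kernel_pow_le_1[OF countable_V column, where v = v and k = k]
  by (auto intro: order_trans)

text \<open>The factor \<rho> costs one power of the decay and leaves the exponent 1 - \<alpha> of
  \<open>dist_sum\<close>. Symmetry of \<rho> turns that sum, which runs over the second argument,
  into a column sum.\<close>

lemma mean_jump:
  assumes "w \<in> V"
  shows "(\<integral>\<^sup>+u. p u w * ennreal (\<rho> u w) \<partial>count_space V) \<le> ennreal (A * S)"
proof -
  have "(\<integral>\<^sup>+u. p u w * ennreal (\<rho> u w) \<partial>count_space V)
      \<le> (\<integral>\<^sup>+u. ennreal A * ennreal ((1 + \<rho> w u) powr (1 - \<alpha>)) \<partial>count_space V)"
  proof (intro nn_integral_mono)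
    fix u assume "u \<in> space (count_space V)"
    then have u: "u \<in> V" by simp
    have n: "\<rho> u w \<ge> 0" using dist_nonneg u assms by simp
    have "p u w * ennreal (\<rho> u w) \<le> ennreal (A * (1 + \<rho> u w) powr (- \<alpha>)) * ennreal (1 + \<rho> u w)"
      by (intro mult_mono decay u assms ennreal_leI) auto
    also have "\<dots> = ennreal (A * (1 + \<rho> u w) powr (- \<alpha>) * (1 + \<rho> u w))"
      using n A_nonneg by (simp add: ennreal_mult)
    also have "(1 + \<rho> u w) powr (1 - \<alpha>) = (1 + \<rho> u w) powr (- \<alpha>) * (1 + \<rho> u w)"
      using n powr_add[of "1 + \<rho> u w" "- \<alpha>" 1] by simp
    then have "A * (1 + \<rho> u w) powr (- \<alpha>) * (1 + \<rho> u w) = A * (1 + \<rho> w u) powr (1 - \<alpha>)"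
      using dist_commute[OF u assms] by (simp add: mult_ac)
    also have "ennreal \<dots> = ennreal A * ennreal ((1 + \<rho> w u) powr (1 - \<alpha>))"
      using A_nonneg by (simp add: ennreal_mult)
    finally show "p u w * ennreal (\<rho> u w) \<le> ennreal A * ennreal ((1 + \<rho> w u) powr (1 - \<alpha>))" .
  qed
  also have "\<dots> = ennreal A * (\<integral>\<^sup>+u. ennreal ((1 + \<rho> w u) powr (1 - \<alpha>)) \<partial>count_space V)"
    by (simp add: nn_integral_cmult)
  also have "\<dots> \<le> ennreal A * ennreal S"
    by (intro mult_left_mono dist_sum assms) simp
  finally show ?thesis using A_nonneg S_nonneg by (simp add: ennreal_mult)
qed

definition truncated :: "real \<Rightarrow> 'a \<Rightarrow> 'a \<Rightarrow> ennreal" where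
  "truncated b u v = (if \<rho> u v \<le> b then p u v else 0)"

text \<open>
  Chernoff's method with weight \<open>Q powr (\<rho> / b)\<close>: on jumps of length at most \<open>b\<close> the weight is at
  most \<open>1 + Q \<rho> / b\<close> by convexity, and for \<open>Q = b / k\<close> the weighted column sums are \<open>1 + O(1 / k)\<close>.
\<close>

lemma kernel_pow_truncated_le:
  assumes "k \<ge> 1" "b \<ge> real k" "u \<in> V" "v \<in> V"
  shows "kernel_pow V (truncated b) k u v \<le> ennreal (exp (A * S) * (b / k) powr (- (\<rho> u v / b)))"
proof -
  define Q where "Q = b / k"
  have Q: "Q \<ge> 1" and b: "b > 0" using assms by (auto simp: Q_def field_simps)
  define \<omega> where "\<omega> = (\<lambda>u v. ennreal (Q powr (\<rho> u v / b)))"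
  have "(\<integral>\<^sup>+u. truncated b u w * \<omega> u w \<partial>count_space V) \<le> ennreal (1 + A * S / k)" if w: "w \<in> V" for w
  proof -
    have "(\<integral>\<^sup>+u. truncated b u w * \<omega> u w \<partial>count_space V)
        \<le> (\<integral>\<^sup>+u. p u w + ennreal (1 / k) * (p u w * ennreal (\<rho> u w)) \<partial>count_space V)"
    proof (intro nn_integral_mono)
      fix u assume "u \<in> space (count_space V)"
      then have u: "u \<in> V" by simp
      have n: "\<rho> u w \<ge> 0" using dist_nonneg u w by simp
      show "truncated b u w * \<omega> u w \<le> p u w + ennreal (1 / k) * (p u w * ennreal (\<rho> u w))"
      proof (cases "\<rho> u w \<le> b")
        case True
        have "Q powr (\<rho> u w / b) * 1 powr (1 - \<rho> u w / b) \<le> (\<rho> u w / b) * Q + (1 - \<rho> u w / b) * 1"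
          using Q b n True by (intro Youngs_inequality_0) auto
        also have "\<dots> \<le> 1 + 1 / k * \<rho> u w"
          using b n by (simp add: Q_def)
        finally have "\<omega> u w \<le> ennreal (1 + 1 / k * \<rho> u w)"
          unfolding \<omega>_def by (intro ennreal_leI) simp
        also have "\<dots> = 1 + ennreal (1 / k) * ennreal (\<rho> u w)"
          using n by (simp add: ennreal_plus ennreal_mult[symmetric])
        finally have "p u w * \<omega> u w \<le> p u w * (1 + ennreal (1 / k) * ennreal (\<rho> u w))"
          by (rule mult_left_mono) simp
        then show ?thesis using True by (simp add: truncated_def distrib_left mult_ac)
      qed (simp add: truncated_def)
    qed
    also have "\<dots> = (\<integral>\<^sup>+u. p u w \<partial>count_space V)
        + ennreal (1 / k) * (\<integral>\<^sup>+u. p u w * ennreal (\<rho> u w) \<partial>count_space V)"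
      by (simp add: nn_integral_add nn_integral_cmult)
    also have "\<dots> \<le> 1 + ennreal (1 / k) * ennreal (A * S)"
      by (intro add_mono mult_left_mono column mean_jump w) auto
    also have "\<dots> = ennreal (1 + A * S / k)"
      using A_nonneg S_nonneg by (simp add: ennreal_plus ennreal_mult[symmetric])
    finally show ?thesis .
  qed
  moreover have "\<omega> u v \<le> \<omega> u w * \<omega> w v" if "u \<in> V" "w \<in> V" "v \<in> V" for u w v
  proof -
    have "Q powr (\<rho> u v / b) \<le> Q powr (\<rho> u w / b + \<rho> w v / b)"
      using dist_triangle[OF that] b Q
      by (intro powr_mono) (auto simp: divide_right_mono simp flip: add_divide_distrib)
    then show ?thesis unfolding \<omega>_def by (simp add: powr_add ennreal_mult[symmetric] ennreal_leI)
  qed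
  moreover have "\<omega> v v \<le> 1" if "v \<in> V" for v
    unfolding \<omega>_def using dist_same[OF that] Q by simp
  ultimately have "(\<integral>\<^sup>+u. kernel_pow V (truncated b) k u v * \<omega> u v \<partial>count_space V)
      \<le> ennreal (1 + A * S / k) ^ k"
    using weighted_column_sum_kernel_pow[OF countable_V, of \<omega> "truncated b"] \<open>v \<in> V\<close> by blast
  also have "\<dots> = ennreal ((1 + A * S / k) ^ k)"
    using A_nonneg S_nonneg by (intro ennreal_power) simp
  also have "\<dots> \<le> ennreal (exp (A * S))"
    using A_nonneg S_nonneg \<open>k \<ge> 1\<close> order_trans[of "- real k" 0 "A * S"]
    by (intro ennreal_leI exp_ge_one_plus_x_over_n_power_n) auto
  finally have "kernel_pow V (truncated b) k u v * \<omega> u v \<le> ennreal (exp (A * S))"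
    using nn_integral_ge_point[OF \<open>u \<in> V\<close>, of "\<lambda>u. kernel_pow V (truncated b) k u v * \<omega> u v"]
    by (rule order_trans[rotated])
  \<comment> \<open>A single entry is at most the weighted column sum; multiplying by the inverse
    weight isolates it.\<close>
  then have "kernel_pow V (truncated b) k u v * \<omega> u v * ennreal (Q powr (- (\<rho> u v / b)))
      \<le> ennreal (exp (A * S)) * ennreal (Q powr (- (\<rho> u v / b)))"
    by (rule mult_right_mono) simp
  moreover have "\<omega> u v * ennreal (Q powr (- (\<rho> u v / b))) = 1"
    using Q by (simp add: \<omega>_def ennreal_mult[symmetric] powr_add[symmetric])
  ultimately show ?thesis
    by (simp add: Q_def mult.assoc ennreal_mult)
qed

text \<open>The coefficients of the paths without and with a long jump. The factor
  \<open>\<alpha> powr \<alpha>\<close> in both comes from putting b = r / \<alpha> into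
  \<open>(b / k) powr (- \<alpha>)\<close> and \<open>b powr (- \<alpha>)\<close>.\<close>

definition c1 :: real where "c1 = exp (A * S) * \<alpha> powr \<alpha>"
definition c2 :: real where "c2 = A * \<alpha> powr \<alpha>"

lemma c1_nonneg: "c1 \<ge> 0" and c2_nonneg: "c2 \<ge> 0"
  using A_nonneg by (auto simp: c1_def c2_def)

text \<open>Splitting off the jumps longer than b, the first term is Chernoff's bound and the second
  collects the long jumps, each of size at most \<open>A * b powr (- \<alpha>)\<close>. Row sums of
  lower powers of \<open>p\<close> remain, to be estimated by
  \<open>row_sums_bounded\<close>.\<close>

lemma kernel_pow_le_row_sums:
  assumes "k \<ge> 1" "u \<in> V" "v \<in> V" "u \<noteq> v"
  shows "kernel_pow V p k u v \<le> ennreal (c1 * real k powr \<alpha> * \<rho> u v powr (- \<alpha>))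
    + ennreal (c2 * \<rho> u v powr (- \<alpha>)) * (\<Sum>i<k. \<integral>\<^sup>+w. kernel_pow V p i u w \<partial>count_space V)"
proof -
  define r where "r = \<rho> u v"
  have r: "r \<ge> 1" using dist_ge_1 assms r_def by simp
  show ?thesis
  proof (cases "r < \<alpha> * k")
    \<comment> \<open>At such short distances the first term is already at least 1.\<close>
    case True
    have "1 \<le> (\<alpha> * k / r) powr \<alpha>"
      using True r alpha by (intro ge_one_powr_ge_zero) auto
    also have "\<dots> = 1 * (\<alpha> powr \<alpha> * real k powr \<alpha> * r powr (- \<alpha>))"
      using r alpha by (simp add: powr_divide powr_mult powr_minus_divide)
    also have "\<dots> \<le> exp (A * S) * (\<alpha> powr \<alpha> * real k powr \<alpha> * r powr (- \<alpha>))"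
      using A_nonneg S_nonneg by (intro mult_right_mono) auto
    finally have "(1::ennreal) \<le> ennreal (c1 * real k powr \<alpha> * r powr (- \<alpha>))"
      by (simp add: c1_def mult_ac)
    with kernel_pow_le_1[OF assms(2,3), of k] show ?thesis
      unfolding r_def[symmetric] by (intro add_increasing2) (auto intro: order_trans)
  next
    case False
    \<comment> \<open>This cut-off makes the Chernoff exponent \<open>\<rho> u v / b\<close> equal
      to \<alpha>, and the case assumption becomes \<open>b \<ge> real k\<close>, as
      \<open>kernel_pow_truncated_le\<close> requires.\<close>
    define b where "b = r / \<alpha>"
    have b: "b \<ge> real k" "b > 0" using False alpha r by (auto simp: b_def field_simps)
    have "p x y \<le> truncated b x y + ennreal (c2 * r powr (- \<alpha>))" if xy: "x \<in> V" "y \<in> V" for x y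
    proof (cases "\<rho> x y \<le> b")
      case False
      have "p x y \<le> ennreal (A * (1 + \<rho> x y) powr (- \<alpha>))" by (rule decay) fact+
      also have "\<dots> \<le> ennreal (A * b powr (- \<alpha>))"
        using b False alpha A_nonneg by (intro ennreal_leI mult_left_mono powr_mono2') auto
      also have "A * b powr (- \<alpha>) = c2 * r powr (- \<alpha>)"
        using r alpha by (simp add: b_def c2_def powr_divide powr_minus_divide)
      finally show ?thesis by (simp add: truncated_def False)
    qed (simp add: truncated_def)
    then have "kernel_pow V p k u v \<le> kernel_pow V (truncated b) k u v
      + ennreal (c2 * r powr (- \<alpha>)) * (\<Sum>i<k. \<integral>\<^sup>+w. kernel_pow V (truncated b) i u w \<partial>count_space V)"
      using kernel_pow_add_le[OF countable_V, of p "truncated b"] column assms by blast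
    also have "\<dots> \<le> ennreal (exp (A * S) * (b / k) powr (- (\<rho> u v / b)))
      + ennreal (c2 * r powr (- \<alpha>)) * (\<Sum>i<k. \<integral>\<^sup>+w. kernel_pow V p i u w \<partial>count_space V)"
      by (intro add_mono mult_left_mono sum_mono nn_integral_mono kernel_pow_mono
          kernel_pow_truncated_le assms b) (auto simp: truncated_def assms)
    also have "exp (A * S) * (b / k) powr (- (\<rho> u v / b)) = c1 * real k powr \<alpha> * r powr (- \<alpha>)"
    proof -
      have "\<rho> u v / b = \<alpha>" using r alpha by (simp add: b_def r_def[symmetric])
      then show ?thesis using r alpha assms(1)
        by (simp add: b_def c1_def powr_divide powr_mult powr_minus_divide)
    qed
    finally show ?thesis by (simp add: r_def)
  qed
qed


text \<open>Strong induction on \<open>k\<close>, feeding the bound for smaller powers into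
  \<open>kernel_pow_le_row_sums\<close>. The bound uses \<open>Suc k\<close> so that it also covers
  k = 0.\<close>

lemma row_sums_bounded:
  obtains K where "K \<ge> 0"
    "\<And>k u. u \<in> V \<Longrightarrow> (\<integral>\<^sup>+v. kernel_pow V p k u v \<partial>count_space V) \<le> ennreal (K * real (Suc k) powr \<alpha>)"
proof -
  \<comment> \<open>\<open>l\<close> makes the feedback of the induction hypothesis,
    \<open>S * c2 * K * 2 powr \<alpha> / l\<close>, at most K / 2. \<open>K\<close> is then large
    enough for the terms that do not involve \<open>K\<close> to total (K - 1) / 2.\<close>
  define l where "l = 1 + 2 * S * c2 * 2 powr \<alpha>"
  define K where "K = 1 + 2 * S * ((1 + l) powr (\<alpha> - 1) + c1 * 2 powr \<alpha>)"
  have l: "l \<ge> 1" using S_nonneg c2_nonneg by (simp add: l_def)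
  have K: "K \<ge> 1" using S_nonneg c1_nonneg by (simp add: K_def)
  have "(\<integral>\<^sup>+v. kernel_pow V p k u v \<partial>count_space V) \<le> ennreal (K * real (Suc k) powr \<alpha>)"
    if "u \<in> V" for k u
    using that
  proof (induction k rule: less_induct)
    case (less k)
    note u = \<open>u \<in> V\<close>
    show ?case
    proof (cases "k = 0")
      case True
      then show ?thesis using row_sum_kernel_pow_0[OF u] K by (simp del: kernel_pow.simps)
    next
      case False
      then have k: "real k \<ge> 1" by simp
      define L where "L = l * k"
      have L: "L \<ge> 1" using mult_mono[of 1 l 1 "real k"] l k by (simp add: L_def)
      \<comment> \<open>The first summand of \<open>g\<close> serves the points within distance
        \<open>L\<close>, where entries are at most 1, and the second the points beyond. Both cases
        are thus bounded by the same multiple of a function with sum at most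
        \<open>S\<close>.\<close>
      define g where "g = (1 + L) powr (\<alpha> - 1) + (c1 + c2 * K) * real k powr (\<alpha> + 1) * 2 powr \<alpha> / L"
      \<comment> \<open>For i < k the hypothesis involves \<open>Suc i\<close>, which is at most
        \<open>k\<close>; adding \<open>k\<close> equal terms raises the exponent to \<alpha> +
        1.\<close>
      have "(\<Sum>i<k. \<integral>\<^sup>+w. kernel_pow V p i u w \<partial>count_space V) \<le> (\<Sum>i<k. ennreal (K * real k powr \<alpha>))"
      proof (intro sum_mono)
        fix i assume i: "i \<in> {..<k}"
        then have "(\<integral>\<^sup>+w. kernel_pow V p i u w \<partial>count_space V) \<le> ennreal (K * real (Suc i) powr \<alpha>)"
          using less.IH u by simp
        also have "\<dots> \<le> ennreal (K * real k powr \<alpha>)"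
          using i K alpha by (intro ennreal_leI mult_left_mono powr_mono2) auto
        finally show "(\<integral>\<^sup>+w. kernel_pow V p i u w \<partial>count_space V) \<le> ennreal (K * real k powr \<alpha>)" .
      qed
      also have "\<dots> = ennreal (K * real k powr (\<alpha> + 1))"
        using K k by (simp add: powr_add ennreal_mult[symmetric] ennreal_of_nat_eq_real_of_nat mult_ac)
      finally have sum: "(\<Sum>i<k. \<integral>\<^sup>+w. kernel_pow V p i u w \<partial>count_space V)
          \<le> ennreal (K * real k powr (\<alpha> + 1))" .
      have "kernel_pow V p k u v \<le> ennreal (g * (1 + \<rho> u v) powr (1 - \<alpha>))" if v: "v \<in> V" for v
      proof (cases "\<rho> u v \<le> L")
        case True
        have "1 = (1 + \<rho> u v) powr (\<alpha> - 1) * (1 + \<rho> u v) powr (1 - \<alpha>)"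
          using dist_nonneg[OF u v] by (simp add: powr_add[symmetric])
        also have "\<dots> \<le> (1 + L) powr (\<alpha> - 1) * (1 + \<rho> u v) powr (1 - \<alpha>)"
          using True dist_nonneg[OF u v] alpha by (intro mult_right_mono powr_mono2) auto
        also have "\<dots> \<le> g * (1 + \<rho> u v) powr (1 - \<alpha>)"
          unfolding g_def using c1_nonneg c2_nonneg K L by (intro mult_right_mono) auto
        finally have "(1::ennreal) \<le> ennreal (g * (1 + \<rho> u v) powr (1 - \<alpha>))" by simp
        then show ?thesis using kernel_pow_le_1[OF u v, of k] by (rule order_trans[rotated])
      next
        case far: False
        define r where "r = \<rho> u v"
        have r: "r > L" using far r_def by simp
        have ne: "u \<noteq> v" using far dist_same u L by auto
        have "kernel_pow V p k u v \<le> ennreal (c1 * real k powr \<alpha> * r powr (- \<alpha>))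
            + ennreal (c2 * r powr (- \<alpha>)) * ennreal (K * real k powr (\<alpha> + 1))"
          unfolding r_def using False u v ne
          by (intro order_trans[OF kernel_pow_le_row_sums] add_left_mono mult_left_mono sum) auto
        also have "\<dots> = ennreal (c1 * real k powr \<alpha> * r powr (- \<alpha>)
            + c2 * r powr (- \<alpha>) * (K * real k powr (\<alpha> + 1)))"
          using c1_nonneg c2_nonneg K by (simp add: ennreal_plus ennreal_mult)
        also have "\<dots> \<le> ennreal (g * (1 + \<rho> u v) powr (1 - \<alpha>))"
        proof (intro ennreal_leI)
          have "c1 * real k powr \<alpha> * r powr (- \<alpha>) \<le> c1 * real k powr (\<alpha> + 1) * r powr (- \<alpha>)"
            using c1_nonneg k by (intro mult_right_mono mult_left_mono powr_mono) auto
          then have "c1 * real k powr \<alpha> * r powr (- \<alpha>) + c2 * r powr (- \<alpha>) * (K * real k powr (\<alpha> + 1))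
              \<le> (c1 + c2 * K) * real k powr (\<alpha> + 1) * r powr (- \<alpha>)"
            by (simp add: algebra_simps)
          \<comment> \<open>Since r is at least 1, it is at least (1 + r) / 2. Of the \<alpha>
            powers of 1 / (1 + r), one is traded for 1 / L, and the others form the summable
            weight.\<close>
          also have "r powr (- \<alpha>) \<le> 2 powr \<alpha> / L * (1 + r) powr (1 - \<alpha>)"
          proof -
            have "r powr (- \<alpha>) \<le> ((1 + r) / 2) powr (- \<alpha>)"
              using r L alpha by (intro powr_mono2') auto
            also have "\<dots> = 2 powr \<alpha> * (1 + r) powr (1 - \<alpha>) / (1 + r)"
              using r L powr_add[of "1 + r" "- \<alpha>" 1] by (simp add: powr_divide powr_minus_divide)
            also have "\<dots> \<le> 2 powr \<alpha> * (1 + r) powr (1 - \<alpha>) / L"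
              using r L by (intro divide_left_mono) auto
            finally show ?thesis by simp
          qed
          then have "(c1 + c2 * K) * real k powr (\<alpha> + 1) * r powr (- \<alpha>)
              \<le> (c1 + c2 * K) * real k powr (\<alpha> + 1) * (2 powr \<alpha> / L * (1 + r) powr (1 - \<alpha>))"
            using c1_nonneg c2_nonneg K by (intro mult_left_mono) auto
          also have "\<dots> \<le> g * (1 + \<rho> u v) powr (1 - \<alpha>)"
            unfolding g_def r_def[symmetric] by (simp add: algebra_simps add_divide_distrib)
          finally show "c1 * real k powr \<alpha> * r powr (- \<alpha>) + c2 * r powr (- \<alpha>) * (K * real k powr (\<alpha> + 1))
              \<le> g * (1 + \<rho> u v) powr (1 - \<alpha>)" .
        qed
        finally show ?thesis .
      qed
      moreover have g: "g \<ge> 0" unfolding g_def using c1_nonneg c2_nonneg K L by auto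
      ultimately have "(\<integral>\<^sup>+v. kernel_pow V p k u v \<partial>count_space V)
          \<le> (\<integral>\<^sup>+v. ennreal g * ennreal ((1 + \<rho> u v) powr (1 - \<alpha>)) \<partial>count_space V)"
        by (intro nn_integral_mono) (simp add: ennreal_mult)
      also have "\<dots> \<le> ennreal g * ennreal S"
        by (simp add: nn_integral_cmult mult_left_mono dist_sum u)
      also have "\<dots> = ennreal (S * g)" using g S_nonneg by (simp add: ennreal_mult mult_ac)
      also have "\<dots> \<le> ennreal (K * real (Suc k) powr \<alpha>)"
      proof (intro ennreal_leI)
        have "(1 + L) powr (\<alpha> - 1) \<le> ((1 + l) * k) powr (\<alpha> - 1)"
          using k l L alpha by (intro powr_mono2) (auto simp: L_def algebra_simps)
        also have "\<dots> = (1 + l) powr (\<alpha> - 1) * real k powr (\<alpha> - 1)"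
          using k l by (simp add: powr_mult)
        also have "\<dots> \<le> (1 + l) powr (\<alpha> - 1) * real k powr \<alpha>"
          using k by (intro mult_left_mono powr_mono) auto
        finally have near: "(1 + L) powr (\<alpha> - 1) \<le> (1 + l) powr (\<alpha> - 1) * real k powr \<alpha>" .
        \<comment> \<open>Dividing by L = l k cancels the power of k gained by summing over the
          times and leaves the factor 1 / l.\<close>
        have "(c1 + c2 * K) * real k powr (\<alpha> + 1) * 2 powr \<alpha> / L = (c1 + c2 * K) * 2 powr \<alpha> / l * real k powr \<alpha>"
          using k l by (simp add: L_def powr_add)
        moreover have "S * ((c1 + c2 * K) * 2 powr \<alpha> / l) \<le> S * c1 * 2 powr \<alpha> + K / 2"
        proof -
          have "S * c1 * 2 powr \<alpha> \<le> S * c1 * 2 powr \<alpha> * l"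
            using mult_left_mono[OF l, of "S * c1 * 2 powr \<alpha>"] S_nonneg c1_nonneg by simp
          moreover have "2 * (S * c2 * K * 2 powr \<alpha>) \<le> K * l"
            using K by (simp add: l_def algebra_simps)
          ultimately show ?thesis using l by (simp add: field_simps)
        qed
        ultimately have "S * g \<le> S * ((1 + l) powr (\<alpha> - 1) * real k powr \<alpha>)
            + (S * c1 * 2 powr \<alpha> + K / 2) * real k powr \<alpha>"
          unfolding g_def distrib_left
          using mult_left_mono[OF near S_nonneg]
            mult_right_mono[of "S * ((c1 + c2 * K) * 2 powr \<alpha> / l)" "S * c1 * 2 powr \<alpha> + K / 2" "real k powr \<alpha>"]
          by (simp add: mult_ac)
        also have "\<dots> = (K - 1 / 2) * real k powr \<alpha>"
          by (simp add: K_def field_simps)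
        also have "\<dots> \<le> K * real (Suc k) powr \<alpha>"
          using K alpha by (intro mult_mono powr_mono2) auto
        finally show "S * g \<le> K * real (Suc k) powr \<alpha>" .
      qed
      finally show ?thesis .
    qed
  qed
  then show thesis using that[of K] K by auto
qed

text \<open>The bound on the row sums is inserted into \<open>kernel_pow_le_row_sums\<close>. The
  sum over the \<open>k\<close> possible times of a long jump accounts for the exponent \<alpha> +
  1.\<close>

lemma kernel_pow_decay:
  obtains C where "C > 0"
    "\<And>k u v. k \<ge> 1 \<Longrightarrow> u \<in> V \<Longrightarrow> v \<in> V \<Longrightarrow> u \<noteq> v \<Longrightarrow>
      kernel_pow V p k u v \<le> ennreal (C * real k powr (\<alpha> + 1) * \<rho> u v powr (- \<alpha>))"
proof -
  obtain K where K: "K \<ge> 0"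
    and row: "\<And>k u. u \<in> V \<Longrightarrow>
      (\<integral>\<^sup>+v. kernel_pow V p k u v \<partial>count_space V) \<le> ennreal (K * real (Suc k) powr \<alpha>)"
    by (rule row_sums_bounded) blast
  define C where "C = c1 + c2 * K + 1"
  have "C > 0" using c1_nonneg c2_nonneg K by (simp add: C_def add_nonneg_pos)
  moreover have "kernel_pow V p k u v \<le> ennreal (C * real k powr (\<alpha> + 1) * \<rho> u v powr (- \<alpha>))"
    if "k \<ge> 1" "u \<in> V" "v \<in> V" "u \<noteq> v" for k u v
  proof -
    define r where "r = \<rho> u v powr (- \<alpha>)"
    have "(\<Sum>i<k. \<integral>\<^sup>+w. kernel_pow V p i u w \<partial>count_space V) \<le> (\<Sum>i<k. ennreal (K * real k powr \<alpha>))"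
    proof (intro sum_mono)
      fix i assume i: "i \<in> {..<k}"
      then have "K * real (Suc i) powr \<alpha> \<le> K * real k powr \<alpha>"
        using K alpha by (intro mult_left_mono powr_mono2) auto
      then show "(\<integral>\<^sup>+w. kernel_pow V p i u w \<partial>count_space V) \<le> ennreal (K * real k powr \<alpha>)"
        using row[OF \<open>u \<in> V\<close>, of i] by (meson ennreal_leI order_trans)
    qed
    also have "\<dots> = ennreal (K * real k powr (\<alpha> + 1))"
      using K \<open>k \<ge> 1\<close>
      by (simp add: powr_add ennreal_mult[symmetric] ennreal_of_nat_eq_real_of_nat mult_ac)
    finally have "kernel_pow V p k u v
        \<le> ennreal (c1 * real k powr \<alpha> * r) + ennreal (c2 * r) * ennreal (K * real k powr (\<alpha> + 1))"
      unfolding r_def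
      by (intro order_trans[OF kernel_pow_le_row_sums[OF that]] add_left_mono mult_left_mono) auto
    also have "\<dots> = ennreal (c1 * real k powr \<alpha> * r + c2 * r * (K * real k powr (\<alpha> + 1)))"
      using c1_nonneg c2_nonneg K by (simp add: ennreal_plus ennreal_mult r_def)
    also have "\<dots> \<le> ennreal (C * real k powr (\<alpha> + 1) * r)"
    proof (intro ennreal_leI)
      have "c1 * real k powr \<alpha> * r \<le> c1 * real k powr (\<alpha> + 1) * r"
        using c1_nonneg \<open>k \<ge> 1\<close> by (intro mult_right_mono mult_left_mono powr_mono) (auto simp: r_def)
      moreover have "0 \<le> real k powr (\<alpha> + 1) * r" by (simp add: r_def)
      ultimately show "c1 * real k powr \<alpha> * r + c2 * r * (K * real k powr (\<alpha> + 1))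
          \<le> C * real k powr (\<alpha> + 1) * r"
        by (simp add: C_def algebra_simps)
    qed
    finally show ?thesis by (simp add: r_def)
  qed
  ultimately show thesis using that by blast
qed

end

section \<open>The geodesic distance as a metric\<close>

lemma walk_single: "v \<in> V \<Longrightarrow> walk V E v [v] v"
  by (simp add: walk_def)

lemma walk_rev: "walk V E u xs v \<Longrightarrow> walk V E v (rev xs) u"
  by (auto simp: walk_def hd_rev last_rev insert_commute)

text \<open>\<open>tl\<close> drops the vertex shared by the two walks, so that edge counts
  add.\<close>

lemma walk_append:
  assumes "walk V E u xs w" "walk V E w ys v"
  shows "walk V E u (xs @ tl ys) v"
proof -
  obtain zs where ys: "ys = w # zs" using assms(2) by (cases ys) (auto simp: walk_def)
  show ?thesis
  proof (cases zs)
    case (Cons z zs')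
    then show ?thesis using assms ys
      by (auto simp: walk_def successively_append_iff successively_Cons)
  qed (use assms ys in \<open>auto simp: walk_def\<close>)
qed

lemma geodesic_dist_le:
  assumes "walk V E u xs v" "length xs = Suc n"
  shows "geodesic_dist V E u v \<le> n"
  unfolding geodesic_dist_def by (rule Least_le) (use assms in blast)

text \<open>Connectedness makes the set under \<open>LEAST\<close> nonempty, so that the minimum is
  attained.\<close>

lemma geodesic_walk:
  assumes "connected_graph V E" "u \<in> V" "v \<in> V"
  obtains xs where "walk V E u xs v" "length xs = Suc (geodesic_dist V E u v)"
proof -
  obtain xs where "walk V E u xs v" using assms by (auto simp: connected_graph_def)
  then have "\<exists>n xs. walk V E u xs v \<and> length xs = Suc n"
    by (intro exI[of _ "length xs - 1"] exI[of _ xs]) (auto simp: walk_def)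
  from LeastI_ex[OF this] show thesis using that unfolding geodesic_dist_def by blast
qed

lemma geodesic_dist_same: "v \<in> V \<Longrightarrow> geodesic_dist V E v v = 0"
  using geodesic_dist_le[OF walk_single, of v V 0 E] by simp

lemma geodesic_dist_eq_0D:
  assumes "connected_graph V E" "u \<in> V" "v \<in> V" "geodesic_dist V E u v = 0"
  shows "u = v"
proof -
  obtain xs where "walk V E u xs v" "length xs = Suc 0"
    using geodesic_walk[OF assms(1-3)] assms(4) by metis
  then show ?thesis by (cases xs) (auto simp: walk_def)
qed

lemma geodesic_dist_commute:
  assumes "connected_graph V E" "u \<in> V" "v \<in> V"
  shows "geodesic_dist V E u v = geodesic_dist V E v u"
proof -
  have "geodesic_dist V E u v \<le> geodesic_dist V E v u" if "u \<in> V" "v \<in> V" for u v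
    using geodesic_walk[OF assms(1) that(2,1)] geodesic_dist_le[OF walk_rev] by (metis length_rev)
  then show ?thesis using assms by (intro antisym) auto
qed

lemma geodesic_dist_triangle:
  assumes "connected_graph V E" "u \<in> V" "w \<in> V" "v \<in> V"
  shows "geodesic_dist V E u v \<le> geodesic_dist V E u w + geodesic_dist V E w v"
proof -
  obtain xs where xs: "walk V E u xs w" "length xs = Suc (geodesic_dist V E u w)"
    using geodesic_walk assms by metis
  obtain ys where ys: "walk V E w ys v" "length ys = Suc (geodesic_dist V E w v)"
    using geodesic_walk assms by metis
  show ?thesis using geodesic_dist_le[OF walk_append[OF xs(1) ys(1)]] xs(2) ys(2) by simp
qed

section \<open>Consequences of polynomial growth and of matrix decay\<close>

text \<open>The infimum defining the dimension need not be attained, but there are admissible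
  exponents below any larger number.\<close>

lemma growth_bound_above_dimension:
  assumes "has_beurling_dimension V E d" "d < e"
  obtains d' D where "0 < d'" "d' < e" "0 < D" "growth_bound V E D d'"
proof -
  define G where "G = {d'. d' > 0 \<and> (\<exists>D>0. growth_bound V E D d')}"
  have "G \<noteq> {}" "Inf G < e" using assms by (auto simp: has_beurling_dimension_def G_def)
  then obtain d' where "d' \<in> G" "d' < e" using cInf_lessD by blast
  then show thesis using that by (auto simp: G_def)
qed

text \<open>Balls have finite counting measure, and those of integer radius around one vertex
  exhaust \<open>V\<close>.\<close>

lemma growth_bound_countable:
  assumes "growth_bound V E D d"
  shows "countable V"
proof (cases "V = {}")
  case False
  then obtain u where u: "u \<in> V" by blast
  have "finite (graph_ball V E u (real n))" for n
  proof -
    have "emeasure (count_space V) (graph_ball V E u (real n)) \<le> ennreal (D * (real n + 1) powr d)"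
      using assms u by (auto simp: growth_bound_def)
    also have "\<dots> < \<infinity>" by simp
    finally show ?thesis
      by (subst (asm) emeasure_count_space) (auto simp: graph_ball_def split: if_splits)
  qed
  moreover have "V = (\<Union>n. graph_ball V E u (real n))" by (auto simp: graph_ball_def)
  ultimately show ?thesis by (metis countable_UN uncountable_infinite countableI_type)
qed simp

text \<open>Dyadic decomposition: \<open>(1 + \<rho>) powr - g\<close> is at most the \<open>n\<close>-th summand for \<open>2 ^ n \<le> 1 + \<rho> < 2 ^ (n + 1)\<close>.\<close>

lemma growth_bound_sum:
  assumes "growth_bound V E D d" "D > 0" "0 < d" "d < g"
  obtains S where "S \<ge> 0"
    "\<And>u. u \<in> V \<Longrightarrow>
      (\<integral>\<^sup>+v. ennreal ((1 + real (geodesic_dist V E u v)) powr (- g)) \<partial>count_space V) \<le> ennreal S"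
proof -
  \<comment> \<open>A dyadic term is a weight \<open>2 powr (- g * n)\<close> times a ball size of
    order \<open>2 powr (d * n)\<close>, so \<open>q\<close> is the ratio of a geometric
    series.\<close>
  define q where "q = 2 powr (d - g)"
  have q: "0 < q" "q < 1" using assms by (auto simp: q_def intro: powr_less_one)
  have sm: "summable (\<lambda>n. D * 2 powr d * q ^ n)" using q by (intro summable_mult summable_geometric) simp
  define S where "S = (\<Sum>n. D * 2 powr d * q ^ n)"
  have "S \<ge> 0" unfolding S_def using sm assms q by (intro suminf_nonneg) auto
  moreover have "(\<integral>\<^sup>+v. ennreal ((1 + real (geodesic_dist V E u v)) powr (- g)) \<partial>count_space V) \<le> ennreal S"
    if u: "u \<in> V" for u
  proof -
    let ?r = "\<lambda>v. real (geodesic_dist V E u v)"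
    \<comment> \<open>\<open>growth_bound\<close> measures balls by R + 1, which for this radius is
      exactly a power of 2.\<close>
    let ?B = "\<lambda>n. graph_ball V E u (2 ^ Suc n - 1)"
    have "(\<integral>\<^sup>+v. ennreal ((1 + ?r v) powr (- g)) \<partial>count_space V)
        \<le> (\<integral>\<^sup>+v. (\<Sum>n. ennreal (2 powr (- g * n)) * indicator (?B n) v) \<partial>count_space V)"
    proof (intro nn_integral_mono)
      fix v assume v: "v \<in> space (count_space V)"
      obtain n where n: "2 ^ n \<le> Suc (geodesic_dist V E u v)" "Suc (geodesic_dist V E u v) < 2 ^ Suc n"
        using ex_power_ivl1[of 2 "Suc (geodesic_dist V E u v)"] by auto
      have n': "2 ^ n \<le> 1 + ?r v" "1 + ?r v < 2 ^ Suc n"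
        using n by (metis of_nat_Suc of_nat_le_iff of_nat_numeral of_nat_power add.commute,
          metis of_nat_Suc of_nat_less_iff of_nat_numeral of_nat_power add.commute)
      have "(1 + ?r v) powr (- g) \<le> (2 ^ n) powr (- g)"
        using n'(1) assms by (intro powr_mono2') auto
      also have "\<dots> = 2 powr (- g * n)"
        by (simp add: powr_powr powr_realpow[symmetric] mult_ac)
      finally have "ennreal ((1 + ?r v) powr (- g)) \<le> ennreal (2 powr (- g * n)) * indicator (?B n) v"
        using n'(2) v by (auto simp: graph_ball_def indicator_def intro!: ennreal_leI)
      also have "h n \<le> suminf h" for h :: "nat \<Rightarrow> ennreal"
        using sum_le_suminf[of h "{n}"] by (simp add: summableI)
      finally show "ennreal ((1 + ?r v) powr (- g)) \<le> (\<Sum>n. ennreal (2 powr (- g * n)) * indicator (?B n) v)" .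
    qed
    also have "\<dots> = (\<Sum>n. ennreal (2 powr (- g * n)) * emeasure (count_space V) (?B n))"
      by (subst nn_integral_suminf) (auto simp: nn_integral_cmult graph_ball_def)
    also have "\<dots> \<le> (\<Sum>n. ennreal (D * 2 powr d * q ^ n))"
    proof (intro suminf_le summableI)
      fix n
      have "emeasure (count_space V) (?B n) \<le> ennreal (D * ((2 ^ Suc n - 1) + 1) powr d)"
        by (rule assms(1)[unfolded growth_bound_def, rule_format, OF u])
          (simp only: diff_ge_0_iff_ge one_le_power one_le_numeral)
      then have "ennreal (2 powr (- g * n)) * emeasure (count_space V) (?B n)
          \<le> ennreal (2 powr (- g * n)) * ennreal (D * (2 ^ Suc n) powr d)"
        by (intro mult_left_mono) auto
      also have "\<dots> = ennreal (2 powr (- g * n) * (D * (2 ^ Suc n) powr d))"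
        using \<open>D > 0\<close> by (simp add: ennreal_mult del: power_Suc)
      also have "2 powr (- g * n) * (D * (2 ^ Suc n) powr d) = D * 2 powr d * q ^ n"
      proof -
        have "((2::real) ^ Suc n) powr d = 2 powr (d * real n + d)"
          by (simp add: powr_powr powr_realpow[symmetric] algebra_simps del: power_Suc)
        moreover have "q ^ n = 2 powr ((d - g) * real n)"
          using q by (simp add: q_def powr_powr powr_realpow[symmetric])
        ultimately show ?thesis by (simp add: powr_add[symmetric] algebra_simps)
      qed
      finally show "ennreal (2 powr (- g * n)) * emeasure (count_space V) (?B n)
          \<le> ennreal (D * 2 powr d * q ^ n)" .
    qed
    also have "\<dots> = ennreal S"
      unfolding S_def using sm assms q by (intro suminf_ennreal2) auto
    finally show ?thesis .
  qed
  ultimately show thesis using that by blast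
qed

text \<open>Both suprema are evaluated at n = \<rho>(u, v), where the entry itself takes
  part.\<close>

lemma Beurling_inf_decay:
  fixes A :: "'a \<Rightarrow> 'a \<Rightarrow> real"
  assumes "A \<in> Beurling_inf V E \<alpha>"
  obtains c where "c \<ge> 0"
    "\<And>u v. u \<in> V \<Longrightarrow> v \<in> V \<Longrightarrow> \<bar>A u v\<bar> \<le> c * (1 + real (geodesic_dist V E u v)) powr (- \<alpha>)"
proof -
  define s where "s = (SUP n. off_diag_sup V E A n * ennreal ((real n + 1) powr \<alpha>))"
  have "s < \<infinity>" using assms by (simp add: Beurling_inf_def s_def)
  then have s: "ennreal (enn2real s) = s" by simp
  have "\<bar>A u v\<bar> \<le> enn2real s * (1 + real (geodesic_dist V E u v)) powr (- \<alpha>)" if "u \<in> V" "v \<in> V" for u v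
  proof -
    let ?n = "geodesic_dist V E u v"
    have "ennreal \<bar>A u v\<bar> \<le> off_diag_sup V E A ?n"
      unfolding off_diag_sup_def by (rule SUP_upper2[of "(u, v)"]) (use that in auto)
    then have "ennreal \<bar>A u v\<bar> * ennreal ((real ?n + 1) powr \<alpha>)
        \<le> off_diag_sup V E A ?n * ennreal ((real ?n + 1) powr \<alpha>)"
      by (rule mult_right_mono) simp
    also have "\<dots> \<le> s" unfolding s_def by (rule SUP_upper) simp
    finally have "ennreal (\<bar>A u v\<bar> * (real ?n + 1) powr \<alpha>) \<le> ennreal (enn2real s)"
      by (simp add: s ennreal_mult)
    then have "\<bar>A u v\<bar> * (real ?n + 1) powr \<alpha> \<le> enn2real s" by (simp add: ennreal_le_iff)
    then show ?thesis by (simp add: powr_minus_divide field_simps)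
  qed
  then show thesis using that[of "enn2real s"] by simp
qed

section \<open>From real matrices to kernels\<close>

lemma nn_integral_count_space_eq_infsum:
  fixes f :: "'a \<Rightarrow> real"
  assumes "f summable_on V" "\<And>v. v \<in> V \<Longrightarrow> f v \<ge> 0"
  shows "(\<integral>\<^sup>+v. ennreal (f v) \<partial>count_space V) = ennreal (infsum f V)"
proof -
  have "(\<lambda>v. norm (f v)) summable_on V"
    using assms by (simp cong: summable_on_cong)
  note abs_summable_equivalent[THEN iffD1, OF this]
  then show ?thesis using nn_integral_conv_infsetsum[of f V] infsetsum_infsum[of f V] assms by simp
qed

text \<open>If \<open>f\<close> is not summable, \<open>infsum\<close> has the default value 0 and
  the inequality is trivial.\<close>

lemma ennreal_infsum_le:
  fixes f :: "'a \<Rightarrow> real"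
  assumes "\<And>v. v \<in> V \<Longrightarrow> f v \<ge> 0"
  shows "ennreal (infsum f V) \<le> (\<integral>\<^sup>+v. ennreal (f v) \<partial>count_space V)"
  using nn_integral_count_space_eq_infsum[of f V] assms
  by (cases "f summable_on V") (auto simp: infsum_not_exists)

text \<open>An inequality suffices for upper bounds and avoids proving that the sums in
  \<open>matrix_pow\<close> converge. Nonnegativity is carried along for the induction.\<close>

lemma kernel_pow_ge_matrix_pow:
  assumes "stochastic_matrix V p" "u \<in> V" "v \<in> V"
  shows "matrix_pow V p k u v \<ge> 0
    \<and> ennreal (matrix_pow V p k u v) \<le> kernel_pow V (\<lambda>u v. ennreal (p u v)) k u v"
  using \<open>u \<in> V\<close>
proof (induction k arbitrary: u)
  case (Suc k)
  have p: "p u w \<ge> 0" if "w \<in> V" for w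
    using assms(1) that Suc.prems by (auto simp: stochastic_matrix_def)
  have n: "p u w * matrix_pow V p k w v \<ge> 0" if "w \<in> V" for w
    using p[OF that] Suc.IH[OF that] by simp
  have "ennreal (matrix_pow V p (Suc k) u v)
      \<le> (\<integral>\<^sup>+w. ennreal (p u w * matrix_pow V p k w v) \<partial>count_space V)"
    using ennreal_infsum_le[OF n] by simp
  also have "\<dots> \<le> kernel_pow V (\<lambda>u v. ennreal (p u v)) (Suc k) u v"
    unfolding kernel_pow.simps
    by (intro nn_integral_mono) (use p Suc.IH in \<open>auto simp: ennreal_mult intro!: mult_left_mono\<close>)
  finally show ?case using n by (simp add: infsum_nonneg)
qed simp

section \<open>Transition probabilities over several steps\<close>

lemma stationary_markov_chain_measurable:
  "stationary_markov_chain M V p X \<Longrightarrow> i \<ge> 1 \<Longrightarrow> X i \<in> M \<rightarrow>\<^sub>M count_space V"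
  by (simp add: stationary_markov_chain_def)

lemma stationary_markov_chain_event:
  assumes "stationary_markov_chain M V p X" "i \<ge> 1" "a \<in> V"
  shows "{\<omega> \<in> space M. X i \<omega> = a} \<in> sets M"
  using measurable_sets[OF stationary_markov_chain_measurable[OF assms(1,2)], of "{a}"] assms(3)
  by (simp add: vimage_def Int_def conj_commute)

text \<open>The Markov property in product form, which also holds for histories of probability 0,
  since both sides then vanish.\<close>

lemma stationary_markov_chain_history_step:
  assumes chain: "stationary_markov_chain M V p X" and "m \<ge> 1" and w: "w \<in> V"
    and h: "\<And>i. i \<in> {1..m} \<Longrightarrow> h i \<in> V"
  shows "\<P>(\<omega> in M. X (Suc m) \<omega> = w \<and> (\<forall>i\<in>{1..m}. X i \<omega> = h i))
    = p w (h m) * \<P>(\<omega> in M. \<forall>i\<in>{1..m}. X i \<omega> = h i)"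
proof -
  interpret prob_space M using chain by (simp add: stationary_markov_chain_def)
  note ev = stationary_markov_chain_event[OF chain]
  have hist: "{\<omega> \<in> space M. \<forall>i\<in>{1..m}. X i \<omega> = h i} \<in> sets M"
    by (intro sets.sets_Collect_finite_All ev h) auto
  show ?thesis
  proof (cases "\<P>(\<omega> in M. \<forall>i\<in>{1..m}. X i \<omega> = h i) > 0")
    case True
    \<comment> \<open>The definition of the chain takes history and next state from one
      sequence.\<close>
    define x where "x = h(Suc m := w)"
    have xV: "\<forall>i\<in>{1..Suc m}. x i \<in> V" using h w by (auto simp: x_def)
    have eq: "(\<forall>i\<in>{1..m}. X i \<omega> = x i) \<longleftrightarrow> (\<forall>i\<in>{1..m}. X i \<omega> = h i)" for \<omega>
      by (auto simp: x_def)
    have xm: "x m = h m" "x (Suc m) = w" by (auto simp: x_def)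
    have "\<P>(\<omega> in M. \<forall>i\<in>{1..m}. X i \<omega> = h i) \<le> \<P>(\<omega> in M. X m \<omega> = h m)"
      using \<open>m \<ge> 1\<close> by (intro finite_measure_mono ev h) auto
    then have "\<P>(\<omega> in M. X m \<omega> = h m) > 0" using True by linarith
    then have "\<P>(\<omega> in M. X (Suc m) \<omega> = w \<bar> X m \<omega> = h m) = p w (h m)"
      using chain \<open>m \<ge> 1\<close> w h[of m] by (simp add: stationary_markov_chain_def)
    moreover have "\<P>(\<omega> in M. X (Suc m) \<omega> = w \<bar> \<forall>i\<in>{1..m}. X i \<omega> = h i)
        = \<P>(\<omega> in M. X (Suc m) \<omega> = w \<bar> X m \<omega> = h m)"
    proof -
      have "\<forall>n\<ge>1. \<forall>x. (\<forall>i\<in>{1..Suc n}. x i \<in> V) \<longrightarrow>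
        \<P>(\<omega> in M. \<forall>i\<in>{1..n}. X i \<omega> = x i) > 0 \<longrightarrow>
        \<P>(\<omega> in M. X (Suc n) \<omega> = x (Suc n) \<bar> \<forall>i\<in>{1..n}. X i \<omega> = x i) =
        \<P>(\<omega> in M. X (Suc n) \<omega> = x (Suc n) \<bar> X n \<omega> = x n)"
        using chain unfolding stationary_markov_chain_def by (elim conjE)
      from this[rule_format, OF \<open>m \<ge> 1\<close>, of x] show ?thesis
        using xV True unfolding eq xm by blast
    qed
    ultimately show ?thesis using True by (simp add: cond_prob_def field_simps)
  next
    case False
    then have "\<P>(\<omega> in M. \<forall>i\<in>{1..m}. X i \<omega> = h i) = 0"
      by (simp add: not_less measure_le_0_iff)
    moreover have "\<P>(\<omega> in M. X (Suc m) \<omega> = w \<and> (\<forall>i\<in>{1..m}. X i \<omega> = h i))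
        \<le> \<P>(\<omega> in M. \<forall>i\<in>{1..m}. X i \<omega> = h i)"
      by (intro finite_measure_mono hist) auto
    ultimately show ?thesis by (simp add: measure_le_0_iff)
  qed
qed

text \<open>The Markov property is given only for complete histories. The event that X m = x and X n
  = v is therefore cut into countably many histories, each of which contributes the same factor
  \<open>p w x\<close>.\<close>

lemma stationary_markov_chain_joint_step:
  assumes chain: "stationary_markov_chain M V p X" and V: "countable V"
    and mn: "1 \<le> n" "n \<le> m" and wxv: "w \<in> V" "x \<in> V" "v \<in> V"
  shows "emeasure M {\<omega> \<in> space M. X (Suc m) \<omega> = w \<and> X m \<omega> = x \<and> X n \<omega> = v}
    = ennreal (p w x) * emeasure M {\<omega> \<in> space M. X m \<omega> = x \<and> X n \<omega> = v}"
proof -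
  interpret prob_space M using chain by (simp add: stationary_markov_chain_def)
  note ev = stationary_markov_chain_event[OF chain]
  note X = stationary_markov_chain_measurable[OF chain]
  \<comment> \<open>Extensional functions make the index unique, so that different histories give
    disjoint events.\<close>
  define I where "I = {h \<in> {1..m} \<rightarrow>\<^sub>E V. h n = v \<and> h m = x}"
  define H where "H = (\<lambda>h. {\<omega> \<in> space M. \<forall>i\<in>{1..m}. X i \<omega> = h i})"
  define W where "W = {\<omega> \<in> space M. X (Suc m) \<omega> = w}"
  have hV: "h i \<in> V" if "h \<in> I" "i \<in> {1..m}" for h i
    using that by (auto simp: I_def)
  have "countable I"
    unfolding I_def using V by (intro countable_Collect countable_PiE) auto
  have H: "H h \<in> sets M" if "h \<in> I" for h
    unfolding H_def by (intro sets.sets_Collect_finite_All ev hV[OF that]) auto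
  have W: "W \<in> sets M" unfolding W_def using ev wxv by simp
  have disj: "disjoint_family_on H I"
    unfolding disjoint_family_on_def
  proof (intro ballI impI, rule ccontr)
    fix h h' assume hh: "h \<in> I" "h' \<in> I" "h \<noteq> h'" "H h \<inter> H h' \<noteq> {}"
    then have "\<forall>i\<in>{1..m}. h i = h' i" by (auto simp: H_def)
    then have "h = h'" using hh by (intro PiE_ext[of h "{1..m}" "\<lambda>_. V" h']) (auto simp: I_def)
    with hh show False by simp
  qed
  have union: "{\<omega> \<in> space M. X m \<omega> = x \<and> X n \<omega> = v} = \<Union>(H ` I)"
  proof safe
    fix \<omega> assume \<omega>: "\<omega> \<in> space M" "x = X m \<omega>" "v = X n \<omega>"
    define h where "h = restrict (\<lambda>i. X i \<omega>) {1..m}"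
    have "h \<in> I" using \<omega> mn measurable_space[OF X \<omega>(1)] by (auto simp: I_def h_def)
    moreover have "\<omega> \<in> H h" using \<omega> by (auto simp: H_def h_def)
    ultimately show "\<omega> \<in> \<Union>(H ` I)" by blast
  qed (use mn in \<open>auto simp: H_def I_def\<close>)
  have step: "emeasure M (W \<inter> H h) = ennreal (p w x) * emeasure M (H h)" if "h \<in> I" for h
  proof -
    have "W \<inter> H h = {\<omega> \<in> space M. X (Suc m) \<omega> = w \<and> (\<forall>i\<in>{1..m}. X i \<omega> = h i)}"
      by (auto simp: W_def H_def)
    then have "measure M (W \<inter> H h) = p w x * measure M (H h)"
      using stationary_markov_chain_history_step[OF chain, of m w h] hV[OF that] mn wxv that
      by (simp add: H_def I_def)
    moreover have "p w x \<ge> 0"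
      using chain wxv by (simp add: stationary_markov_chain_def stochastic_matrix_def)
    ultimately show ?thesis by (simp add: emeasure_eq_measure ennreal_mult)
  qed
  have "{\<omega> \<in> space M. X (Suc m) \<omega> = w \<and> X m \<omega> = x \<and> X n \<omega> = v} = W \<inter> \<Union>(H ` I)"
    unfolding union[symmetric] W_def by auto
  also have "\<dots> = (\<Union>h\<in>I. W \<inter> H h)" by blast
  also have "emeasure M \<dots> = (\<integral>\<^sup>+h. emeasure M (W \<inter> H h) \<partial>count_space I)"
    using disj by (intro emeasure_UN_countable \<open>countable I\<close> sets.Int W H)
      (auto simp: disjoint_family_on_def)
  also have "\<dots> = (\<integral>\<^sup>+h. ennreal (p w x) * emeasure M (H h) \<partial>count_space I)"
    by (intro nn_integral_cong step) simp
  also have "\<dots> = ennreal (p w x) * emeasure M (\<Union>(H ` I))"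
    by (simp add: nn_integral_cmult emeasure_UN_countable[OF H \<open>countable I\<close> disj])
  finally show ?thesis by (simp add: union)
qed

text \<open>Chapman-Kolmogorov by induction on \<open>k\<close>, splitting by the value of X (n +
  k). Joint probabilities replace conditional ones, so no division by 0 arises.\<close>

lemma stationary_markov_chain_joint:
  assumes chain: "stationary_markov_chain M V p X" and V: "countable V"
    and n: "1 \<le> n" and uv: "u \<in> V" "v \<in> V"
  shows "emeasure M {\<omega> \<in> space M. X (n + k) \<omega> = u \<and> X n \<omega> = v}
    = kernel_pow V (\<lambda>u v. ennreal (p u v)) k u v * emeasure M {\<omega> \<in> space M. X n \<omega> = v}"
  using \<open>u \<in> V\<close>
proof (induction k arbitrary: u)
  case 0
  have "{\<omega> \<in> space M. X n \<omega> = u \<and> X n \<omega> = v} = (if u = v then {\<omega> \<in> space M. X n \<omega> = v} else {})"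
    by auto
  then show ?case by simp
next
  case (Suc k)
  interpret prob_space M using chain by (simp add: stationary_markov_chain_def)
  let ?e = "emeasure M {\<omega> \<in> space M. X n \<omega> = v}"
  let ?B = "\<lambda>x. {\<omega> \<in> space M. X (Suc (n + k)) \<omega> = u \<and> X (n + k) \<omega> = x \<and> X n \<omega> = v}"
  note ev = stationary_markov_chain_event[OF chain]
  note X = stationary_markov_chain_measurable[OF chain]
  have "{\<omega> \<in> space M. X (n + Suc k) \<omega> = u \<and> X n \<omega> = v} = (\<Union>x\<in>V. ?B x)"
    using measurable_space[OF X, of "n + k"] n by auto
  also have "emeasure M \<dots> = (\<integral>\<^sup>+x. emeasure M (?B x) \<partial>count_space V)"
    using V n Suc.prems uv
    by (intro emeasure_UN_countable sets.sets_Collect_conj ev) (auto simp: disjoint_family_on_def)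
  also have "\<dots> = (\<integral>\<^sup>+x. ennreal (p u x) * kernel_pow V (\<lambda>u v. ennreal (p u v)) k x v * ?e \<partial>count_space V)"
  proof (intro nn_integral_cong)
    fix x assume "x \<in> space (count_space V)"
    then have x: "x \<in> V" by simp
    show "emeasure M (?B x) = ennreal (p u x) * kernel_pow V (\<lambda>u v. ennreal (p u v)) k x v * ?e"
      using stationary_markov_chain_joint_step[OF chain V n, of "n + k" u x v] Suc x uv
      by (simp add: mult.assoc)
  qed
  also have "\<dots> = kernel_pow V (\<lambda>u v. ennreal (p u v)) (Suc k) u v * ?e"
    by (simp add: nn_integral_multc)
  finally show ?case .
qed

text \<open>Both branches of \<open>chain_prob\<close> are controlled by the same kernel power: the
  quotient through the joint law, the matrix entry through
  \<open>kernel_pow_ge_matrix_pow\<close>.\<close>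

lemma chain_prob_le:
  assumes chain: "stationary_markov_chain M V p X" and V: "countable V"
    and mn: "1 \<le> n" "n < m" and uv: "u \<in> V" "v \<in> V"
    and B: "kernel_pow V (\<lambda>u v. ennreal (p u v)) (m - n) u v \<le> ennreal B" "B \<ge> 0"
  shows "chain_prob M V p X m n u v \<le> B"
proof (cases "\<P>(\<omega> in M. X n \<omega> = v) > 0")
  case True
  interpret prob_space M using chain by (simp add: stationary_markov_chain_def)
  have "emeasure M {\<omega> \<in> space M. X m \<omega> = u \<and> X n \<omega> = v}
      \<le> ennreal B * emeasure M {\<omega> \<in> space M. X n \<omega> = v}"
    using stationary_markov_chain_joint[OF chain V mn(1) uv, of "m - n"] mn B(1)
    by (simp add: mult_right_mono)
  then have "\<P>(\<omega> in M. X m \<omega> = u \<and> X n \<omega> = v) \<le> B * \<P>(\<omega> in M. X n \<omega> = v)"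
    using B(2) by (simp add: emeasure_eq_measure ennreal_mult[symmetric])
  then show ?thesis using True by (simp add: chain_prob_def cond_prob_def divide_le_eq)
next
  case False
  have "ennreal (matrix_pow V p (m - n) u v) \<le> ennreal B"
    using kernel_pow_ge_matrix_pow[of V p u v "m - n"] chain uv B(1)
    by (auto simp: stationary_markov_chain_def intro: order_trans)
  then show ?thesis using False B(2) by (simp add: chain_prob_def)
qed

theorem corollary6p2:
  fixes V :: "'a set" and E :: "'a set set" and P :: "'a \<Rightarrow> 'a \<Rightarrow> real" and d \<alpha> :: real
  assumes "simple_graph V E" and "connected_graph V E"
    and "has_beurling_dimension V E d" and "normal_counting_measure V E d"
    and "\<alpha> > d + 1" and "P \<in> Beurling_inf V E \<alpha>"
  shows "\<exists>C>0. \<forall>(M :: 'b measure) X. stationary_markov_chain M V P X \<longrightarrow>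
    (\<forall>u\<in>V. \<forall>v\<in>V. \<forall>m n. 1 \<le> n \<and> n < m \<longrightarrow>
       chain_prob M V P X m n u v \<le>
         (if u = v then 1
          else min (C * real (m - n) powr (\<alpha> + 1) * real (geodesic_dist V E u v) powr (- \<alpha>)) 1))"
proof (cases "stochastic_matrix V P")
  \<comment> \<open>No chain has such a transition matrix, so any \<open>C\<close> will do. The case
    distinction makes stochasticity available before \<open>C\<close> is chosen, independently of
    the chain.\<close>
  case False
  then show ?thesis by (intro exI[of _ 1]) (simp add: stationary_markov_chain_def)
next
  case True
  let ?\<rho> = "\<lambda>u v. real (geodesic_dist V E u v)"
  have "d < \<alpha> - 1" using assms(5) by simp
  \<comment> \<open>The strict inequality \<alpha> > d + 1 leaves room for an admissible exponent
    below \<alpha> - 1.\<close>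
  then obtain d' D where dD: "0 < d'" "d' < \<alpha> - 1" "0 < D" "growth_bound V E D d'"
    by (rule growth_bound_above_dimension[OF assms(3)])
  obtain S where S: "S \<ge> 0" "\<And>u. u \<in> V \<Longrightarrow>
      (\<integral>\<^sup>+v. ennreal ((1 + ?\<rho> u v) powr (- (\<alpha> - 1))) \<partial>count_space V) \<le> ennreal S"
    using growth_bound_sum[OF dD(4,3,1,2)] by metis
  obtain A where A: "A \<ge> 0"
    "\<And>u v. u \<in> V \<Longrightarrow> v \<in> V \<Longrightarrow> \<bar>P u v\<bar> \<le> A * (1 + ?\<rho> u v) powr (- \<alpha>)"
    using Beurling_inf_decay[OF assms(6)] by metis
  have V: "countable V" by (rule growth_bound_countable) (rule dD)
  interpret decaying_kernel V ?\<rho> "\<lambda>u v. ennreal (P u v)" \<alpha> A S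
  proof
    show "1 \<le> ?\<rho> u v" if "u \<in> V" "v \<in> V" "u \<noteq> v" for u v
      using geodesic_dist_eq_0D[OF assms(2), of u v] that by (cases "geodesic_dist V E u v") auto
    show "?\<rho> u v \<le> ?\<rho> u w + ?\<rho> w v" if "u \<in> V" "w \<in> V" "v \<in> V" for u w v
      using geodesic_dist_triangle[OF assms(2) that] by linarith
    show "(\<integral>\<^sup>+v. ennreal ((1 + ?\<rho> u v) powr (1 - \<alpha>)) \<partial>count_space V) \<le> ennreal S"
      if "u \<in> V" for u using S(2)[OF that] by simp
    show "ennreal (P u v) \<le> ennreal (A * (1 + ?\<rho> u v) powr (- \<alpha>))" if "u \<in> V" "v \<in> V" for u v
      using A(2)[OF that] by (intro ennreal_leI) linarith
    show "(\<integral>\<^sup>+u. ennreal (P u v) \<partial>count_space V) \<le> 1" if "v \<in> V" for v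
    proof -
      have "((\<lambda>u. P u v) has_sum 1) V" "\<And>u. u \<in> V \<Longrightarrow> P u v \<ge> 0"
        using True that by (auto simp: stochastic_matrix_def)
      then show ?thesis
        using nn_integral_count_space_eq_infsum[of "\<lambda>u. P u v" V]
        by (simp add: has_sum_imp_summable infsumI)
    qed
  qed (use V S A dD geodesic_dist_same geodesic_dist_commute[OF assms(2)] in auto)
  obtain C where C: "C > 0" "\<And>k u v. k \<ge> 1 \<Longrightarrow> u \<in> V \<Longrightarrow> v \<in> V \<Longrightarrow> u \<noteq> v \<Longrightarrow>
      kernel_pow V (\<lambda>u v. ennreal (P u v)) k u v \<le> ennreal (C * real k powr (\<alpha> + 1) * ?\<rho> u v powr (- \<alpha>))"
    by (rule kernel_pow_decay) blast
  have "chain_prob M V P X m n u v \<le>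
         (if u = v then 1 else min (C * real (m - n) powr (\<alpha> + 1) * ?\<rho> u v powr (- \<alpha>)) 1)"
    if "stationary_markov_chain M V P X" "u \<in> V" "v \<in> V" "1 \<le> n" "n < m"
    for M :: "'b measure" and X u v m n
  proof -
    \<comment> \<open>Used twice: with the bound 1 and with the decay bound, the two arguments of
      \<open>min\<close>.\<close>
    note le = chain_prob_le[OF that(1) V that(4,5,2,3)]
    have "chain_prob M V P X m n u v \<le> 1"
      using kernel_pow_le_1[OF that(2,3)] by (intro le) auto
    moreover have "chain_prob M V P X m n u v \<le> C * real (m - n) powr (\<alpha> + 1) * ?\<rho> u v powr (- \<alpha>)"
      if "u \<noteq> v"
      using C(1) \<open>u \<in> V\<close> \<open>v \<in> V\<close> \<open>n < m\<close> by (intro le C(2) that) auto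
    ultimately show ?thesis by (cases "u = v") simp_all
  qed
  with \<open>C > 0\<close> show ?thesis by blast
qed

end
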